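(* Let $m\in\mathbb{Z}$, and set $R_m:=U_m(x_0,x_1)\,U_m(x_1,x_0)^{-1}\in F(x_0,x_1)$, where $$U_m(x_0,x_1)=\begin{cases}(x_1x_0^{-1})^{m/2}\,x_1^{-1}, & m \text{ even},\\ x_0\,(x_1x_0^{-1})^{(m-1)/2}\,x_1, & m\text{ odd}.\end{cases}$$ Then the group $G_m=\langle x_0,x_1\mid R_m\rangle$ is isomorphic to $BS(1,m)=\langle a,t\mid t^{-1}at=a^m\rangle$.
   Context: $F(x_0,x_1)$ is the free group with basis $\{x_0,x_1\}$. For a word $U(x_0,x_1)\in F(x_0,x_1)$, $U(x_1,x_0)$ denotes its image under the automorphism of $F(x_0,x_1)$ interchanging $x_0$ and $x_1$. The integer $m$ may be zero or negative. *)

theory Defs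
  imports "HOL-Algebra.Algebra"
begin

section \<open>Free groups as groups of reduced words\<close>

text \<open>A letter is a generator \<open>g\<close> (encoded as \<open>(g, True)\<close>) or its formal inverse
  (encoded as \<open>(g, False)\<close>).\<close>

type_synonym 'a letter = "'a \<times> bool"
type_synonym 'a word = "'a letter list"

definition inv_letter :: "'a letter \<Rightarrow> 'a letter" where
  "inv_letter x = (fst x, \<not> snd x)"

definition reduced :: "'a word \<Rightarrow> bool" where
  "reduced w \<longleftrightarrow> successively (\<lambda>x y. y \<noteq> inv_letter x) w"

fun cancel_cons :: "'a letter \<Rightarrow> 'a word \<Rightarrow> 'a word" where
  "cancel_cons x [] = [x]"
| "cancel_cons x (y # ys) = (if y = inv_letter x then ys else x # y # ys)"

definition free_group :: "'a set \<Rightarrow> 'a word monoid" where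
  "free_group S =
    \<lparr>carrier = {w. reduced w \<and> fst ` set w \<subseteq> S},
     monoid.mult = (\<lambda>u v. foldr cancel_cons u v),
     one = []\<rparr>"

definition gen :: "'a \<Rightarrow> 'a word" where
  "gen g = [(g, True)]"

lemma inv_letter_inv_letter [simp]: "inv_letter (inv_letter x) = x"
  by (simp add: inv_letter_def)

lemma fst_inv_letter [simp]: "fst (inv_letter x) = fst x"
  by (simp add: inv_letter_def)

lemma reduced_Nil [simp]: "reduced []"
  by (simp add: reduced_def)

lemma reduced_singleton [simp]: "reduced [x]"
  by (simp add: reduced_def)

lemma reduced_Cons_Cons [simp]:
  "reduced (x # y # w) \<longleftrightarrow> y \<noteq> inv_letter x \<and> reduced (y # w)"
  by (simp add: reduced_def)

lemma reduced_ConsD: "reduced (x # w) \<Longrightarrow> reduced w"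
  by (cases w) auto

lemma reduced_cancel_cons: "reduced w \<Longrightarrow> reduced (cancel_cons x w)"
  by (cases w) (auto dest: reduced_ConsD)

lemma cancel_cons_inverse: "reduced w \<Longrightarrow> cancel_cons x (cancel_cons (inv_letter x) w) = w"
proof (cases w)
  case (Cons y ys)
  assume "reduced w"
  with Cons show ?thesis by (cases ys) auto
qed simp

lemma cancel_cons_inverse': "reduced w \<Longrightarrow> cancel_cons (inv_letter x) (cancel_cons x w) = w"
  using cancel_cons_inverse[of w "inv_letter x"] by simp

lemma cancel_cons_reduced: "reduced (x # w) \<Longrightarrow> cancel_cons x w = x # w"
  by (cases w) auto

lemma reduced_foldr: "reduced v \<Longrightarrow> reduced (foldr cancel_cons u v)"
  by (induction u) (auto intro: reduced_cancel_cons)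

lemma foldr_cancel_cons:
  "reduced v \<Longrightarrow> foldr cancel_cons (cancel_cons x u) v = cancel_cons x (foldr cancel_cons u v)"
  by (cases u) (auto simp: cancel_cons_inverse reduced_foldr)

lemma foldr_assoc:
  "reduced w \<Longrightarrow>
    foldr cancel_cons (foldr cancel_cons u v) w = foldr cancel_cons u (foldr cancel_cons v w)"
  by (induction u) (auto simp: foldr_cancel_cons)

lemma foldr_Nil_reduced: "reduced u \<Longrightarrow> foldr cancel_cons u [] = u"
proof (induction u)
  case (Cons x u)
  then show ?case using reduced_ConsD[of x u] cancel_cons_reduced[of x u] by simp
qed simp

lemma set_cancel_cons: "set (cancel_cons x w) \<subseteq> insert x (set w)"
  by (cases w) auto

lemma set_foldr: "set (foldr cancel_cons u v) \<subseteq> set u \<union> set v"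
proof (induction u)
  case (Cons x u)
  then show ?case using set_cancel_cons[of x "foldr cancel_cons u v"] by auto
qed simp

lemma foldr_left_inverse: "foldr cancel_cons (rev (map inv_letter u)) u = []"
  by (induction u) (auto simp: cancel_cons_inverse)

lemma reduced_inverse: "reduced u \<Longrightarrow> reduced (rev (map inv_letter u))"
proof (induction u)
  case (Cons x u)
  then show ?case
    by (cases u) (auto simp: reduced_def successively_append_iff inv_letter_def prod_eq_iff)
qed simp

lemma free_group_is_group: "group (free_group S)"
proof (rule groupI)
  fix u v assume "u \<in> carrier (free_group S)" "v \<in> carrier (free_group S)"
  moreover have "fst ` set (foldr cancel_cons u v) \<subseteq> fst ` set u \<union> fst ` set v"
    using image_mono[OF set_foldr[of u v], of fst] by (simp only: image_Un)
  ultimately show "u \<otimes>\<^bsub>free_group S\<^esub> v \<in> carrier (free_group S)"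
    by (simp add: free_group_def reduced_foldr) (meson Un_least subset_trans)
next
  fix u assume u: "u \<in> carrier (free_group S)"
  show "\<exists>v\<in>carrier (free_group S). v \<otimes>\<^bsub>free_group S\<^esub> u = \<one>\<^bsub>free_group S\<^esub>"
  proof (rule bexI)
    show "rev (map inv_letter u) \<otimes>\<^bsub>free_group S\<^esub> u = \<one>\<^bsub>free_group S\<^esub>"
      by (simp add: free_group_def foldr_left_inverse)
    show "rev (map inv_letter u) \<in> carrier (free_group S)"
      using u by (simp add: free_group_def reduced_inverse image_image)
  qed
qed (simp_all add: free_group_def foldr_assoc)

lemma gen_in_carrier: "g \<in> S \<Longrightarrow> gen g \<in> carrier (free_group S)"
  by (simp add: free_group_def gen_def)

lemma inv_gen:
  assumes "g \<in> S"
  shows "inv\<^bsub>free_group S\<^esub> gen g = [(g, False)]"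
proof -
  interpret group "free_group S" by (rule free_group_is_group)
  show ?thesis
    by (rule inv_equality)
      (use assms in \<open>auto simp: free_group_def gen_def inv_letter_def\<close>)
qed

text \<open>The universal property of \<^term>\<open>free_group S\<close> with basis \<^term>\<open>gen ` S\<close>.\<close>

definition free_lift :: "('b, 'c) monoid_scheme \<Rightarrow> ('a \<Rightarrow> 'b) \<Rightarrow> 'a word \<Rightarrow> 'b" where
  "free_lift G f w =
    foldr (\<lambda>x z. (if snd x then f (fst x) else inv\<^bsub>G\<^esub> f (fst x)) \<otimes>\<^bsub>G\<^esub> z) w \<one>\<^bsub>G\<^esub>"

lemma free_lift_closed:
  assumes "group G" "f \<in> S \<rightarrow> carrier G" "fst ` set w \<subseteq> S"
  shows "free_lift G f w \<in> carrier G"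
proof -
  interpret group G by fact
  show ?thesis using assms(3)
    by (induction w) (use assms(2) in \<open>auto simp: free_lift_def\<close>)
qed

lemma free_lift_cancel_cons:
  assumes "group G" "f \<in> S \<rightarrow> carrier G" "fst ` set (x # w) \<subseteq> S"
  shows "free_lift G f (cancel_cons x w) = free_lift G f (x # w)"
proof (cases "\<exists>ys. w = inv_letter x # ys")
  case True
  interpret group G by fact
  obtain ys where w: "w = inv_letter x # ys" using True by blast
  have f: "f (fst x) \<in> carrier G" using assms by auto
  have ys: "free_lift G f ys \<in> carrier G"
    by (rule free_lift_closed[OF assms(1,2)]) (use assms(3) w in auto)
  then show ?thesis using f w
    by (auto simp: free_lift_def inv_letter_def m_assoc[symmetric])
next
  case False
  then have "cancel_cons x w = x # w" by (cases w) auto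
  then show ?thesis by simp
qed

lemma free_lift_hom:
  assumes "group G" "f \<in> S \<rightarrow> carrier G"
  shows "free_lift G f \<in> hom (free_group S) G"
proof (rule homI)
  interpret group G by fact
  show "free_lift G f u \<in> carrier G" if "u \<in> carrier (free_group S)" for u
    using that by (intro free_lift_closed[OF assms]) (auto simp: free_group_def)
  have *: "free_lift G f (foldr cancel_cons u v) = free_lift G f u \<otimes>\<^bsub>G\<^esub> free_lift G f v"
    if "fst ` set u \<subseteq> S" "fst ` set v \<subseteq> S" for u v
    using that
  proof (induction u)
    case Nil
    then show ?case using free_lift_closed[OF assms, of v] by (simp add: free_lift_def)
  next
    case (Cons x u)
    have f: "f (fst x) \<in> carrier G" using assms Cons.prems by auto
    have sub: "fst ` set (x # foldr cancel_cons u v) \<subseteq> S"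
      using set_foldr[of u v] Cons.prems by fastforce
    have c: "free_lift G f u \<in> carrier G" "free_lift G f v \<in> carrier G"
      using free_lift_closed[OF assms, of u] free_lift_closed[OF assms, of v] Cons.prems by auto
    have "free_lift G f (foldr cancel_cons (x # u) v) = free_lift G f (x # foldr cancel_cons u v)"
      using free_lift_cancel_cons[OF assms sub] by simp
    also have "\<dots> = (if snd x then f (fst x) else inv\<^bsub>G\<^esub> f (fst x)) \<otimes>\<^bsub>G\<^esub>
        free_lift G f (foldr cancel_cons u v)"
      by (simp add: free_lift_def)
    also have "\<dots> = free_lift G f (x # u) \<otimes>\<^bsub>G\<^esub> free_lift G f v"
      using Cons f c by (simp add: m_assoc) (simp add: free_lift_def m_assoc)
    finally show ?case .
  qed
  show "free_lift G f (u \<otimes>\<^bsub>free_group S\<^esub> v) = free_lift G f u \<otimes>\<^bsub>G\<^esub> free_lift G f v"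
    if "u \<in> carrier (free_group S)" "v \<in> carrier (free_group S)" for u v
    using *[of u v] that by (auto simp: free_group_def)
qed

lemma free_lift_gen:
  assumes "group G" "f \<in> S \<rightarrow> carrier G" "g \<in> S"
  shows "free_lift G f (gen g) = f g"
proof -
  interpret group G by fact
  have "f g \<in> carrier G" using assms(2,3) by blast
  then show ?thesis by (simp add: free_lift_def gen_def)
qed

lemma free_lift_unique:
  assumes "group G" "h \<in> hom (free_group S) G" "\<And>g. g \<in> S \<Longrightarrow> h (gen g) = f g"
    and "w \<in> carrier (free_group S)"
  shows "h w = free_lift G f w"
  using assms(4)
proof (induction w)
  case Nil
  have "h \<one>\<^bsub>free_group S\<^esub> = \<one>\<^bsub>G\<^esub>"
    using assms(1,2) free_group_is_group hom_one by blast
  then show ?case by (simp add: free_lift_def free_group_def)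
next
  case (Cons x w)
  interpret h: group_hom "free_group S" G h
    using assms(1,2) free_group_is_group
    by (auto simp: group_hom_def group_hom_axioms_def)
  have x: "fst x \<in> S" using Cons.prems by (auto simp: free_group_def)
  have w: "w \<in> carrier (free_group S)"
    using Cons.prems by (auto simp: free_group_def dest: reduced_ConsD)
  have xc: "[x] \<in> carrier (free_group S)" using x by (simp add: free_group_def)
  have "x # w = [x] \<otimes>\<^bsub>free_group S\<^esub> w"
    using Cons.prems by (simp add: free_group_def cancel_cons_reduced)
  then have "h (x # w) = h [x] \<otimes>\<^bsub>G\<^esub> h w" using xc w by simp
  moreover have "h [x] = (if snd x then f (fst x) else inv\<^bsub>G\<^esub> f (fst x))"
  proof (cases "snd x")
    case True
    then have "[x] = gen (fst x)" by (cases x) (simp add: gen_def)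
    then show ?thesis using assms(3)[OF x] True by simp
  next
    case False
    then have "[x] = inv\<^bsub>free_group S\<^esub> gen (fst x)"
      using inv_gen[OF x] by (cases x) simp
    then show ?thesis using assms(3)[OF x] False gen_in_carrier[OF x] by simp
  qed
  ultimately show ?case using Cons.IH[OF w] by (simp add: free_lift_def)
qed

section \<open>Group presentations\<close>

definition normal_closure :: "('a, 'b) monoid_scheme \<Rightarrow> 'a set \<Rightarrow> 'a set" where
  "normal_closure G R = \<Inter> {N. N \<lhd> G \<and> R \<subseteq> N}"

definition presented_group :: "'a set \<Rightarrow> 'a word set \<Rightarrow> 'a word set monoid" where
  "presented_group S R = free_group S Mod normal_closure (free_group S) R"

lemma normal_closure_subset: "R \<subseteq> normal_closure G R"
  by (auto simp: normal_closure_def)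

lemma normal_closure_least: "N \<lhd> G \<Longrightarrow> R \<subseteq> N \<Longrightarrow> normal_closure G R \<subseteq> N"
  by (auto simp: normal_closure_def)

lemma normal_closure_normal:
  assumes "group G" "R \<subseteq> carrier G"
  shows "normal_closure G R \<lhd> G"
proof -
  interpret group G by fact
  have "carrier G \<lhd> G"
    by (simp add: normal_inv_iff subgroup_self)
  then have ne: "{N. N \<lhd> G \<and> R \<subseteq> N} \<noteq> {}" using assms(2) by blast
  have "subgroup (\<Inter> {N. N \<lhd> G \<and> R \<subseteq> N}) G"
    by (rule subgroups_Inter) (use ne normal_imp_subgroup in auto)
  then show ?thesis
    unfolding normal_closure_def normal_inv_iff by blast
qed

lemma presented_group_is_group:
  "R \<subseteq> carrier (free_group S) \<Longrightarrow> group (presented_group S R)"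
  unfolding presented_group_def
  by (intro normal.factorgroup_is_group normal_closure_normal free_group_is_group)

section \<open>The two families of groups\<close>

datatype xgen = X0 | X1

abbreviation F01 :: "xgen word monoid" where
  "F01 \<equiv> free_group UNIV"

abbreviation x0 :: "xgen word" where "x0 \<equiv> gen X0"
abbreviation x1 :: "xgen word" where "x1 \<equiv> gen X1"

fun swap_xgen :: "xgen \<Rightarrow> xgen" where
  "swap_xgen X0 = X1"
| "swap_xgen X1 = X0"

definition swap_F :: "xgen word \<Rightarrow> xgen word" where
  "swap_F = map (map_prod swap_xgen id)"

lemma swap_xgen_swap_xgen [simp]: "swap_xgen (swap_xgen g) = g"
  by (cases g) auto

lemma swap_F_gens: "swap_F x0 = x1" "swap_F x1 = x0"
  by (simp_all add: swap_F_def gen_def)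

lemma swap_F_swap_F [simp]: "swap_F (swap_F w) = w"
  by (induction w) (auto simp: swap_F_def map_prod_def)

lemma swap_F_iso: "swap_F \<in> iso F01 F01"
proof -
  have letter: "map_prod swap_xgen id y = inv_letter (map_prod swap_xgen id x) \<longleftrightarrow> y = inv_letter x"
    for x y
    by (cases x; cases y) (auto simp: inv_letter_def, (metis swap_xgen_swap_xgen)+)
  have red: "reduced (swap_F w) \<longleftrightarrow> reduced w" for w
    by (simp add: reduced_def swap_F_def successively_map letter)
  have cc: "swap_F (cancel_cons x w) = cancel_cons (map_prod swap_xgen id x) (swap_F w)" for x w
    by (cases w) (auto simp: swap_F_def letter)
  have "swap_F (foldr cancel_cons u v) = foldr cancel_cons (swap_F u) (swap_F v)" for u v
    by (induction u) (auto simp: cc, simp_all add: swap_F_def)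
  then have "swap_F \<in> hom F01 F01"
    by (auto simp: hom_def free_group_def red)
  moreover have "bij_betw swap_F (carrier F01) (carrier F01)"
    by (rule bij_betw_byWitness[where f' = swap_F]) (auto simp: free_group_def red)
  ultimately show ?thesis by (simp add: iso_def)
qed

definition U_word :: "int \<Rightarrow> xgen word" where
  "U_word m =
    (if even m
     then (x1 \<otimes>\<^bsub>F01\<^esub> inv\<^bsub>F01\<^esub> x0) [^]\<^bsub>F01\<^esub> (m div 2) \<otimes>\<^bsub>F01\<^esub> inv\<^bsub>F01\<^esub> x1
     else x0 \<otimes>\<^bsub>F01\<^esub> (x1 \<otimes>\<^bsub>F01\<^esub> inv\<^bsub>F01\<^esub> x0) [^]\<^bsub>F01\<^esub> ((m - 1) div 2) \<otimes>\<^bsub>F01\<^esub> x1)"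

definition R_word :: "int \<Rightarrow> xgen word" where
  "R_word m = U_word m \<otimes>\<^bsub>F01\<^esub> inv\<^bsub>F01\<^esub> (swap_F (U_word m))"

definition G_pres :: "int \<Rightarrow> xgen word set monoid" where
  "G_pres m = presented_group UNIV {R_word m}"

datatype bsgen = gen_a | gen_t

abbreviation F_at :: "bsgen word monoid" where
  "F_at \<equiv> free_group UNIV"

abbreviation bs_a :: "bsgen word" where "bs_a \<equiv> gen gen_a"
abbreviation bs_t :: "bsgen word" where "bs_t \<equiv> gen gen_t"

text \<open>The relation \<open>t\<^sup>-\<^sup>1 a t = a\<^sup>m\<close> is encoded as the relator \<open>t\<^sup>-\<^sup>1 a t (a\<^sup>m)\<^sup>-\<^sup>1\<close>.\<close>

definition BS1 :: "int \<Rightarrow> bsgen word set monoid" where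
  "BS1 m = presented_group UNIV
    {inv\<^bsub>F_at\<^esub> bs_t \<otimes>\<^bsub>F_at\<^esub> bs_a \<otimes>\<^bsub>F_at\<^esub> bs_t \<otimes>\<^bsub>F_at\<^esub> inv\<^bsub>F_at\<^esub> (bs_a [^]\<^bsub>F_at\<^esub> m)}"

end

theory Submission
  imports Defs
begin

text \<open>
  Put \<open>y = x\<^sub>1 x\<^sub>0\<^sup>-\<^sup>1\<close>. The interchange of \<open>x\<^sub>0\<close> and \<open>x\<^sub>1\<close> turns \<open>y\<close> into \<open>y\<^sup>-\<^sup>1\<close>, so the two factors
  of \<open>R\<^sub>m\<close> combine to
    \<^item> \<open>y\<^sup>k (x\<^sub>1\<^sup>-\<^sup>1 x\<^sub>0) y\<^sup>k\<close> for \<open>m = 2k\<close>,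
    \<^item> \<open>x\<^sub>0 (y\<^sup>k y y\<^sup>k) x\<^sub>1\<^sup>-\<^sup>1\<close> for \<open>m = 2k + 1\<close>.
  In either case killing \<open>R\<^sub>m\<close> amounts to \<open>x\<^sub>0\<^sup>-\<^sup>1 x\<^sub>1 = y\<^sup>m\<close>. Since \<open>x\<^sub>1 = y x\<^sub>0\<close>, this is the relation
  \<open>x\<^sub>0\<^sup>-\<^sup>1 y x\<^sub>0 = y\<^sup>m\<close>, which is the defining relation of \<open>BS(1,m)\<close> for \<open>a = y\<close> and \<open>t = x\<^sub>0\<close>.

  The change of generators \<open>(x\<^sub>0, x\<^sub>1) = (t, a t)\<close>, \<open>(a, t) = (x\<^sub>1 x\<^sub>0\<^sup>-\<^sup>1, x\<^sub>0)\<close> is invertible. It is carried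
  out with the universal property of a presented group (\<open>presented_group_lift\<close>), which needs to know
  only which assignments of the generators in an arbitrary group kill the relators. This is
  \<open>R_word_trivial_iff\<close> on one side and \<open>BS_relator_trivial_iff\<close> on the other.
\<close>

section \<open>The universal property of a presented group\<close>

definition pres_class :: "'a set \<Rightarrow> 'a word set \<Rightarrow> 'a word \<Rightarrow> 'a word set" where
  "pres_class S R w = normal_closure (free_group S) R #>\<^bsub>free_group S\<^esub> w"

lemma pres_class_hom:
  assumes "R \<subseteq> carrier (free_group S)"
  shows "pres_class S R \<in> hom (free_group S) (presented_group S R)"
  unfolding pres_class_def[abs_def] presented_group_def
  by (rule normal.r_coset_hom_Mod) (rule normal_closure_normal[OF free_group_is_group assms])

lemma carrier_presented_group:
  "carrier (presented_group S R) = pres_class S R ` carrier (free_group S)"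
  by (auto simp: presented_group_def pres_class_def carrier_FactGroup)

lemma free_lift_eq_pres_class:
  assumes "R \<subseteq> carrier (free_group S)" "w \<in> carrier (free_group S)"
  shows "free_lift (presented_group S R) (\<lambda>g. pres_class S R (gen g)) w = pres_class S R w"
  by (rule free_lift_unique[symmetric])
    (use assms in \<open>auto intro: presented_group_is_group pres_class_hom\<close>)

lemma free_lift_relator:
  assumes R: "R \<subseteq> carrier (free_group S)" and r: "r \<in> R"
  shows "free_lift (presented_group S R) (\<lambda>g. pres_class S R (gen g)) r = \<one>\<^bsub>presented_group S R\<^esub>"
proof -
  interpret N: normal "normal_closure (free_group S) R" "free_group S"
    by (rule normal_closure_normal[OF free_group_is_group R])
  have "r \<in> normal_closure (free_group S) R"
    by (rule subsetD[OF normal_closure_subset r])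
  then have "pres_class S R r = \<one>\<^bsub>presented_group S R\<^esub>"
    unfolding pres_class_def presented_group_def one_FactGroup
    by (rule N.rcos_const[OF free_group_is_group])
  then show ?thesis
    using free_lift_eq_pres_class[OF R subsetD[OF R r]] by simp
qed

text \<open>Von Dyck's theorem: the normal closure of the relators lies in the kernel of the homomorphism
  that \<open>f\<close> induces on the free group, because that kernel is normal.\<close>

lemma presented_group_lift:
  assumes "group G" and R: "R \<subseteq> carrier (free_group S)" and f: "f \<in> S \<rightarrow> carrier G"
    and trivial: "\<And>r. r \<in> R \<Longrightarrow> free_lift G f r = \<one>\<^bsub>G\<^esub>"
  obtains h where "h \<in> hom (presented_group S R) G"
    and "\<And>g. g \<in> S \<Longrightarrow> h (pres_class S R (gen g)) = f g"
proof -
  interpret fl: group_hom "free_group S" G "free_lift G f"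
    using assms(1) free_group_is_group free_lift_hom[OF assms(1) f]
    by (auto simp: group_hom_def group_hom_axioms_def)
  have "normal_closure (free_group S) R \<subseteq> kernel (free_group S) G (free_lift G f)"
    by (rule normal_closure_least) (use R trivial fl.normal_kernel in \<open>auto simp: kernel_def\<close>)
  then obtain h where h: "h \<in> hom (presented_group S R) G"
    "\<And>w. w \<in> carrier (free_group S) \<Longrightarrow> h (pres_class S R w) = free_lift G f w"
    using fl.FactGroup_universal_kernel[OF normal_closure_normal[OF free_group_is_group R]]
    unfolding presented_group_def pres_class_def by metis
  show thesis
    by (rule that[OF h(1)]) (simp add: h(2) gen_in_carrier free_lift_gen[OF assms(1) f])
qed

lemma presented_group_hom_ext:
  assumes "group G" and R: "R \<subseteq> carrier (free_group S)"
    and h: "h \<in> hom (presented_group S R) G" and k: "k \<in> hom (presented_group S R) G"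
    and gens: "\<And>g. g \<in> S \<Longrightarrow> h (pres_class S R (gen g)) = k (pres_class S R (gen g))"
    and x: "x \<in> carrier (presented_group S R)"
  shows "h x = k x"
proof -
  obtain w where w: "w \<in> carrier (free_group S)" and xw: "x = pres_class S R w"
    using x by (auto simp: carrier_presented_group)
  let ?f = "\<lambda>g. k (pres_class S R (gen g))"
  have "(h \<circ> pres_class S R) w = free_lift G ?f w"
    by (rule free_lift_unique[OF assms(1) hom_compose[OF pres_class_hom[OF R] h] _ w])
      (simp add: gens)
  moreover have "(k \<circ> pres_class S R) w = free_lift G ?f w"
    by (rule free_lift_unique[OF assms(1) hom_compose[OF pres_class_hom[OF R] k] _ w]) simp
  ultimately show ?thesis
    by (simp add: xw)
qed

text \<open>The two composites are endomorphisms that fix the generators, hence identities.\<close>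

lemma presented_groups_isoI:
  assumes R: "R \<subseteq> carrier (free_group S)" and Q: "Q \<subseteq> carrier (free_group T)"
    and h: "h \<in> hom (presented_group S R) (presented_group T Q)"
    and k: "k \<in> hom (presented_group T Q) (presented_group S R)"
    and kh: "\<And>g. g \<in> S \<Longrightarrow> k (h (pres_class S R (gen g))) = pres_class S R (gen g)"
    and hk: "\<And>g. g \<in> T \<Longrightarrow> h (k (pres_class T Q (gen g))) = pres_class T Q (gen g)"
  shows "presented_group S R \<cong> presented_group T Q"
proof -
  have "(k \<circ> h) x = id x" if "x \<in> carrier (presented_group S R)" for x
    by (rule presented_group_hom_ext[OF presented_group_is_group[OF R] R hom_compose[OF h k]])
      (use that kh in \<open>auto simp: hom_def\<close>)
  moreover have "(h \<circ> k) y = id y" if "y \<in> carrier (presented_group T Q)" for y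
    by (rule presented_group_hom_ext[OF presented_group_is_group[OF Q] Q hom_compose[OF k h]])
      (use that hk in \<open>auto simp: hom_def\<close>)
  ultimately have "group_isomorphisms (presented_group S R) (presented_group T Q) h k"
    using h k by (simp add: group_isomorphisms_def)
  then show ?thesis
    by (intro is_isoI) (rule group_isomorphisms_imp_iso)
qed

section \<open>Evaluating the relators in an arbitrary group\<close>

lemma free_lift_swap_F: "free_lift G f (swap_F w) = free_lift G (f \<circ> swap_xgen) w"
  by (induction w) (simp_all add: free_lift_def swap_F_def)

lemma U_word_closed: "U_word m \<in> carrier F01"
proof -
  interpret F: group F01 by (rule free_group_is_group)
  show ?thesis
    by (simp add: U_word_def gen_in_carrier)
qed

lemma swap_F_closed: "w \<in> carrier F01 \<Longrightarrow> swap_F w \<in> carrier F01"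
  using swap_F_iso by (auto simp: iso_def hom_def)

lemma R_word_closed: "R_word m \<in> carrier F01"
proof -
  interpret F: group F01 by (rule free_group_is_group)
  show ?thesis
    by (simp add: R_word_def U_word_closed swap_F_closed)
qed

lemma BS_relator_closed:
  "inv\<^bsub>F_at\<^esub> bs_t \<otimes>\<^bsub>F_at\<^esub> bs_a \<otimes>\<^bsub>F_at\<^esub> bs_t \<otimes>\<^bsub>F_at\<^esub> inv\<^bsub>F_at\<^esub> (bs_a [^]\<^bsub>F_at\<^esub> (m::int)) \<in> carrier F_at"
proof -
  interpret F: group F_at by (rule free_group_is_group)
  show ?thesis
    by (simp add: gen_in_carrier)
qed

context group
begin

lemma free_lift_group_hom:
  assumes "f \<in> S \<rightarrow> carrier G"
  shows "group_hom (free_group S) G (free_lift G f)"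
  using free_lift_hom[OF is_group assms] free_group_is_group is_group
  by (simp add: group_hom_def group_hom_axioms_def)

lemma free_lift_U_word:
  assumes f: "f \<in> UNIV \<rightarrow> carrier G"
  shows "free_lift G f (U_word m) =
    (if even m then (f X1 \<otimes> inv f X0) [^] (m div 2) \<otimes> inv f X1
     else f X0 \<otimes> (f X1 \<otimes> inv f X0) [^] ((m - 1) div 2) \<otimes> f X1)"
proof -
  interpret fl: group_hom F01 G "free_lift G f"
    by (rule free_lift_group_hom[OF f])
  show ?thesis
    by (simp add: U_word_def gen_in_carrier fl.hom_int_pow free_lift_gen[OF is_group f])
qed

text \<open>For \<open>m = 2k\<close> the value of \<open>R\<^sub>m\<close> has this shape, with \<open>c = x\<^sub>0\<^sup>-\<^sup>1 x\<^sub>1\<close> and \<open>p = y\<^sup>k\<close>.\<close>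

lemma sandwich_inv_eq_one_iff:
  assumes [simp]: "p \<in> carrier G" "c \<in> carrier G"
  shows "p \<otimes> inv c \<otimes> p = \<one> \<longleftrightarrow> c = p \<otimes> p"
proof -
  have "p \<otimes> inv c \<otimes> p = \<one> \<longleftrightarrow> \<one> = p \<otimes> inv c \<otimes> p"
    by (rule eq_commute)
  also have "\<dots> \<longleftrightarrow> p \<otimes> inv c = \<one> \<otimes> inv p"
    by (rule inv_solve_right[symmetric]) simp_all
  also have "\<dots> \<longleftrightarrow> p \<otimes> inv c = inv p"
    by (simp only: l_one inv_closed assms)
  also have "\<dots> \<longleftrightarrow> p = inv p \<otimes> c"
    by (rule inv_solve_right') simp_all
  also have "\<dots> \<longleftrightarrow> c = p \<otimes> p"
    by (rule inv_solve_left) simp_all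
  finally show ?thesis .
qed

text \<open>The value of \<open>R\<^sub>m\<close> simplifies because the swapped word contains \<open>x\<^sub>0 x\<^sub>1\<^sup>-\<^sup>1 = y\<^sup>-\<^sup>1\<close>. The powers of
  \<open>y\<close> on the two sides then add up to \<open>y\<^sup>m\<close>, whatever the sign of \<open>m\<close>.\<close>

lemma R_word_trivial_iff:
  assumes f: "f \<in> UNIV \<rightarrow> carrier G"
  shows "free_lift G f (R_word m) = \<one> \<longleftrightarrow>
    inv f X0 \<otimes> (f X1 \<otimes> inv f X0) \<otimes> f X0 = (f X1 \<otimes> inv f X0) [^] m"
proof -
  interpret fl: group_hom F01 G "free_lift G f"
    by (rule free_lift_group_hom[OF f])
  define u v y where "u = f X0" and "v = f X1" and "y = v \<otimes> inv u"
  have [simp]: "u \<in> carrier G" "v \<in> carrier G" "y \<in> carrier G"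
    using f by (auto simp: u_def v_def y_def)
  have swap: "u \<otimes> inv v = inv y"
    by (simp add: y_def inv_mult_group)
  have conj: "inv u \<otimes> y \<otimes> u = inv u \<otimes> v"
    by (simp add: y_def m_assoc)
  have f_swap: "f \<circ> swap_xgen \<in> UNIV \<rightarrow> carrier G"
    using f by auto
  have R_eval: "free_lift G f (R_word m) =
      free_lift G f (U_word m) \<otimes> inv free_lift G (f \<circ> swap_xgen) (U_word m)"
    by (simp add: R_word_def U_word_closed swap_F_closed free_lift_swap_F)
  have U: "free_lift G f (U_word m) =
      (if even m then y [^] (m div 2) \<otimes> inv v else u \<otimes> y [^] ((m - 1) div 2) \<otimes> v)"
    unfolding u_def v_def y_def by (rule free_lift_U_word[OF f])
  have U_swap: "free_lift G (f \<circ> swap_xgen) (U_word m) =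
      (if even m then inv (y [^] (m div 2)) \<otimes> inv u else v \<otimes> inv (y [^] ((m - 1) div 2)) \<otimes> u)"
    by (simp only: free_lift_U_word[OF f_swap] o_apply swap_xgen.simps u_def[symmetric]
        v_def[symmetric] swap int_pow_inv \<open>y \<in> carrier G\<close>)
  have "free_lift G f (R_word m) = \<one> \<longleftrightarrow> inv u \<otimes> v = y [^] m"
  proof (cases "even m")
    case True
    then obtain k where m: "m = 2 * k" by blast
    then have m_half: "m div 2 = k" by simp
    define p where "p = y [^] k"
    have [simp]: "p \<in> carrier G" by (simp add: p_def)
    have pp: "p \<otimes> p = y [^] m"
      by (simp add: p_def m int_pow_mult[symmetric])
    have "free_lift G f (R_word m) = p \<otimes> inv v \<otimes> inv (inv p \<otimes> inv u)"
      by (simp only: R_eval U U_swap True if_True m_half p_def)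
    also have "\<dots> = p \<otimes> inv (inv u \<otimes> v) \<otimes> p"
      by (simp add: inv_mult_group m_assoc)
    finally show ?thesis
      using sandwich_inv_eq_one_iff[of p "inv u \<otimes> v"] by (simp add: pp)
  next
    case False
    then obtain k where m: "m = 2 * k + 1" by (blast elim: oddE)
    then have m_half: "(m - 1) div 2 = k" by simp
    define p where "p = y [^] k"
    have [simp]: "p \<in> carrier G" by (simp add: p_def)
    have "p \<otimes> y \<otimes> p = y [^] (k + 1 + k)"
      by (simp only: int_pow_mult p_def int_pow_1 \<open>y \<in> carrier G\<close>)
    then have pyp: "p \<otimes> y \<otimes> p = y [^] m"
      by (simp add: m)
    have "free_lift G f (R_word m) = u \<otimes> p \<otimes> v \<otimes> inv (v \<otimes> inv p \<otimes> u)"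
      by (simp only: R_eval U U_swap False if_False m_half p_def)
    also have "\<dots> = u \<otimes> (p \<otimes> y \<otimes> p) \<otimes> inv v"
      by (simp add: inv_mult_group m_assoc y_def)
    also have "\<dots> = \<one> \<longleftrightarrow> v = u \<otimes> (p \<otimes> y \<otimes> p)"
      by (subst inv_solve_right') auto
    also have "\<dots> \<longleftrightarrow> inv u \<otimes> v = p \<otimes> y \<otimes> p"
      by (rule inv_solve_left'[symmetric]) auto
    finally show ?thesis
      by (simp only: pyp)
  qed
  then show ?thesis
    by (simp only: conj u_def[symmetric] v_def[symmetric] y_def[symmetric])
qed

lemma BS_relator_trivial_iff:
  assumes f: "f \<in> UNIV \<rightarrow> carrier G"
  shows "free_lift G f (inv\<^bsub>F_at\<^esub> bs_t \<otimes>\<^bsub>F_at\<^esub> bs_a \<otimes>\<^bsub>F_at\<^esub> bs_t \<otimes>\<^bsub>F_at\<^esub> inv\<^bsub>F_at\<^esub> (bs_a [^]\<^bsub>F_at\<^esub> (m::int))) = \<one>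
    \<longleftrightarrow> inv f gen_t \<otimes> f gen_a \<otimes> f gen_t = f gen_a [^] m"
proof -
  interpret fl: group_hom F_at G "free_lift G f"
    by (rule free_lift_group_hom[OF f])
  have [simp]: "f g \<in> carrier G" for g
    using f by auto
  show ?thesis
    by (simp add: gen_in_carrier fl.hom_int_pow free_lift_gen[OF is_group f] inv_solve_right')
qed

end

section \<open>The change of generators\<close>

theorem lemma9:
  fixes m :: int
  shows "G_pres m \<cong> BS1 m"
proof -
  let ?r = "inv\<^bsub>F_at\<^esub> bs_t \<otimes>\<^bsub>F_at\<^esub> bs_a \<otimes>\<^bsub>F_at\<^esub> bs_t \<otimes>\<^bsub>F_at\<^esub> inv\<^bsub>F_at\<^esub> (bs_a [^]\<^bsub>F_at\<^esub> m)"
  have R: "{R_word m} \<subseteq> carrier F01" and Q: "{?r} \<subseteq> carrier F_at"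
    using R_word_closed BS_relator_closed by auto
  define P where "P = presented_group UNIV {R_word m}"
  define B where "B = presented_group UNIV {?r}"
  interpret P: group P
    unfolding P_def by (rule presented_group_is_group[OF R])
  interpret B: group B
    unfolding B_def by (rule presented_group_is_group[OF Q])
  define x where "x g = pres_class UNIV {R_word m} (gen g)" for g
  define b where "b g = pres_class UNIV {?r} (gen g)" for g
  have x: "x \<in> UNIV \<rightarrow> carrier P" and b: "b \<in> UNIV \<rightarrow> carrier B"
    by (auto simp: x_def b_def P_def B_def carrier_presented_group gen_in_carrier)
  then have [simp]: "x g \<in> carrier P" "b c \<in> carrier B" for g c
    by auto
  have "free_lift P x (R_word m) = \<one>\<^bsub>P\<^esub>"
    using free_lift_relator[OF R] unfolding P_def x_def by simp
  then have P_rel: "inv\<^bsub>P\<^esub> x X0 \<otimes>\<^bsub>P\<^esub> (x X1 \<otimes>\<^bsub>P\<^esub> inv\<^bsub>P\<^esub> x X0) \<otimes>\<^bsub>P\<^esub> x X0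
      = (x X1 \<otimes>\<^bsub>P\<^esub> inv\<^bsub>P\<^esub> x X0) [^]\<^bsub>P\<^esub> m"
    using P.R_word_trivial_iff[OF x] by simp
  have "free_lift B b ?r = \<one>\<^bsub>B\<^esub>"
    using free_lift_relator[OF Q] unfolding B_def b_def by simp
  then have B_rel: "inv\<^bsub>B\<^esub> b gen_t \<otimes>\<^bsub>B\<^esub> b gen_a \<otimes>\<^bsub>B\<^esub> b gen_t = b gen_a [^]\<^bsub>B\<^esub> m"
    using B.BS_relator_trivial_iff[OF b] by simp

  have at_cancel: "b gen_a \<otimes>\<^bsub>B\<^esub> b gen_t \<otimes>\<^bsub>B\<^esub> inv\<^bsub>B\<^esub> b gen_t = b gen_a"
    by (simp add: B.m_assoc)
  define f where "f = case_xgen (b gen_t) (b gen_a \<otimes>\<^bsub>B\<^esub> b gen_t)"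
  have f: "f \<in> UNIV \<rightarrow> carrier B"
    by (auto simp: f_def split: xgen.split)
  have "free_lift B f (R_word m) = \<one>\<^bsub>B\<^esub>"
    by (simp add: B.R_word_trivial_iff[OF f]) (simp add: f_def at_cancel B_rel)
  then obtain h where h: "h \<in> hom P B" and h_gen: "\<And>g. h (x g) = f g"
    using presented_group_lift[OF B.is_group R f] unfolding P_def x_def by auto

  define l where "l = case_bsgen (x X1 \<otimes>\<^bsub>P\<^esub> inv\<^bsub>P\<^esub> x X0) (x X0)"
  have l: "l \<in> UNIV \<rightarrow> carrier P"
    by (auto simp: l_def split: bsgen.split)
  have "free_lift P l ?r = \<one>\<^bsub>P\<^esub>"
    by (simp add: P.BS_relator_trivial_iff[OF l]) (simp add: l_def P_rel)
  then obtain k where k: "k \<in> hom B P" and k_gen: "\<And>g. k (b g) = l g"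
    using presented_group_lift[OF P.is_group Q l] unfolding B_def b_def by auto

  interpret h: group_hom P B h
    using h by (simp add: group_hom_def group_hom_axioms_def P.is_group B.is_group)
  interpret k: group_hom B P k
    using k by (simp add: group_hom_def group_hom_axioms_def P.is_group B.is_group)
  have "k (h (x g)) = x g" for g
    by (cases g) (simp_all add: h_gen f_def k_gen l_def P.m_assoc)
  moreover have "h (k (b g)) = b g" for g
    by (cases g) (simp_all add: k_gen l_def h_gen f_def at_cancel)
  ultimately have "presented_group UNIV {R_word m} \<cong> presented_group UNIV {?r}"
    using h k unfolding P_def B_def x_def b_def by (intro presented_groups_isoI[OF R Q]) auto
  then show ?thesis
    by (simp add: G_pres_def BS1_def)
qed

end
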